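(* A graph $G$ is a $2$-$\chi_i$-game-vertex-critical graph if and only if $G=K_2$.
   Context: All graphs are simple, undirected and finite. The indicated coloring game on a graph $G$ with color set $\{1,\ldots,k\}$ is played by Ann and Ben. In every round Ann selects a previously uncolored vertex and Ben colors it with any color from $\{1,\ldots,k\}$ that has not been used on its neighbors. Ann's goal is a proper coloring of the whole graph; Ben wins if at some point there is an uncolored vertex having all colors $1,\ldots,k$ in its neighborhood. The indicated chromatic number $\chi_i(G)$ is the minimum $k$ for which Ann has a winning strategy on $G$, no matter how Ben plays. For $x\in V(G)$, $G-x$ is the graph obtained from $G$ by deleting $x$ and all edges incident with $x$. A graph $G$ is $k$-$\chi_i$-game-vertex-critical if $\chi_i(G)=k$ and $\chi_i(G-x)\neq\chi_i(G)$ for every $x\in V(G)$. $K_n$ is the complete graph of order $n$; equality of graphs means isomorphism. *)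

theory Defs
  imports "Graph_Theory.Graph_Theory"
begin

text \<open>
  Finite simple undirected graphs are the symmetric digraphs of locale \<^locale>\<open>graph\<close>: an edge
  is a pair of opposite arcs, and adjacency of \<open>u\<close> and \<open>v\<close> is \<open>u \<rightarrow>\<^bsub>G\<^esub> v\<close>.
  A partial colouring is a map whose domain is the set of coloured vertices.
\<close>

definition proper_coloring :: "('a, 'b) pre_digraph \<Rightarrow> nat \<Rightarrow> ('a \<rightharpoonup> nat) \<Rightarrow> bool" where
  "proper_coloring G k c \<longleftrightarrow>
     dom c = verts G \<and> ran c \<subseteq> {1..k} \<and> (\<forall>u v. u \<rightarrow>\<^bsub>G\<^esub> v \<longrightarrow> c u \<noteq> c v)"

definition legal_colors :: "('a, 'b) pre_digraph \<Rightarrow> nat \<Rightarrow> ('a \<rightharpoonup> nat) \<Rightarrow> 'a \<Rightarrow> nat set" where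
  "legal_colors G k c v = {a \<in> {1..k}. \<forall>w. v \<rightarrow>\<^bsub>G\<^esub> w \<longrightarrow> c w \<noteq> Some a}"

definition ben_wins :: "('a, 'b) pre_digraph \<Rightarrow> nat \<Rightarrow> ('a \<rightharpoonup> nat) \<Rightarrow> bool" where
  "ben_wins G k c \<longleftrightarrow>
     (\<exists>v \<in> verts G - dom c. \<forall>a \<in> {1..k}. \<exists>w. v \<rightarrow>\<^bsub>G\<^esub> w \<and> c w = Some a)"

text \<open>
  A history lists the rounds played so far, latest first, as pairs of the vertex selected by Ann
  and the colour given by Ben; \<open>map_of h\<close> is the resulting partial colouring. A strategy of Ann
  selects a vertex depending on the history. The predicate below describes the histories that
  can arise when Ann follows \<open>s\<close> and Ben plays arbitrary legal colours; the game stops as soon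
  as Ben has won.
\<close>

inductive play ::
  "('a, 'b) pre_digraph \<Rightarrow> nat \<Rightarrow> (('a \<times> nat) list \<Rightarrow> 'a) \<Rightarrow> ('a \<times> nat) list \<Rightarrow> bool"
  for G k s where
  start: "play G k s []"
| round: "\<lbrakk> play G k s h; \<not> ben_wins G k (map_of h);
            s h \<in> verts G - dom (map_of h); a \<in> legal_colors G k (map_of h) (s h) \<rbrakk>
          \<Longrightarrow> play G k s ((s h, a) # h)"

text \<open>
  A play of a winning strategy that cannot be continued has coloured the whole graph. Selecting
  an invalid vertex ends the play, so a strategy doing this before the graph is coloured is
  not winning. Plays never recolour a vertex, so there are no infinite plays to consider on a
  finite graph.
\<close>

definition ann_winning_strategy ::
  "('a, 'b) pre_digraph \<Rightarrow> nat \<Rightarrow> (('a \<times> nat) list \<Rightarrow> 'a) \<Rightarrow> bool" where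
  "ann_winning_strategy G k s \<longleftrightarrow>
     (\<forall>h. play G k s h \<and> (\<nexists>r. play G k s (r # h)) \<longrightarrow> proper_coloring G k (map_of h))"

definition indicated_chromatic_number :: "('a, 'b) pre_digraph \<Rightarrow> nat" (\<open>\<chi>\<^sub>i\<close>) where
  "\<chi>\<^sub>i G = (LEAST k. \<exists>s. ann_winning_strategy G k s)"

definition game_vertex_critical :: "nat \<Rightarrow> ('a, 'b) pre_digraph \<Rightarrow> bool" where
  "game_vertex_critical k G \<longleftrightarrow>
     \<chi>\<^sub>i G = k \<and> (\<forall>x \<in> verts G. \<chi>\<^sub>i (pre_digraph.del_vert G x) \<noteq> \<chi>\<^sub>i G)"

end

theory Submission
  imports Defs
begin

text \<open>
  For \<open>k = 2\<close> Ann wins exactly on the bipartite graphs: she selects a vertex with a coloured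
  neighbour whenever there is one, so that Ben's colour is forced, and otherwise the coloured set
  is a union of components, so that any colour of the next vertex agrees with a 2-colouring up to
  swapping the colours outside that set. Hence \<open>\<chi>\<^sub>i = 2\<close> characterises bipartite graphs with an
  edge, and this property survives the deletion of every vertex that is not an end of a given
  edge.
\<close>

context graph
begin

section \<open>Elementary properties of plays\<close>

lemma dominates_sym: "u \<rightarrow> v \<Longrightarrow> v \<rightarrow> u"
  using arcs_ends_symmetric[OF sym_arcs] .

lemma proper_coloring_value:
  assumes "proper_coloring G k c" "v \<in> verts G"
  obtains a where "c v = Some a" "a \<in> {1..k}"
proof -
  from assms have "v \<in> dom c" by (simp only: proper_coloring_def)
  then obtain a where "c v = Some a" by blast
  with that assms(1) ranI[of c v a] show thesis unfolding proper_coloring_def by blast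
qed

lemma play_dom: "play G k s h \<Longrightarrow> dom (map_of h) \<subseteq> verts G"
proof (induction rule: play.induct)
  case (round h a)
  then have "insert (s h) (dom (map_of h)) \<subseteq> verts G" by blast
  then show ?case by (simp only: map_of.simps dom_fun_upd option.distinct if_False fst_conv snd_conv simp_thms)
qed simp

lemma play_ran: "play G k s h \<Longrightarrow> ran (map_of h) \<subseteq> {1..k}"
proof (induction rule: play.induct)
  case (round h a)
  then show ?case by (auto simp: legal_colors_def ran_def split: if_splits)
qed auto

lemma play_distinct: "play G k s h \<Longrightarrow> distinct (map fst h)"
  by (induction rule: play.induct) (auto simp: dom_map_of_conv_image_fst)

text \<open>Either end of the arc may be the vertex coloured last; symmetry of adjacency lets the
  legality of that last move cover both cases.\<close>

lemma play_proper:
  "play G k s h \<Longrightarrow> u \<rightarrow> v \<Longrightarrow> map_of h u = Some a \<Longrightarrow> map_of h v \<noteq> Some a"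
proof (induction arbitrary: u v a rule: play.induct)
  case (round h b)
  have "u \<noteq> v" using round.prems(1) adj_not_same by blast
  then show ?case
    using round dominates_sym[OF round.prems(1)]
    by (auto simp: legal_colors_def split: if_splits)
qed auto

lemma play_length: "play G k s h \<Longrightarrow> length h \<le> card (verts G)"
  using play_dom[of k s h] play_distinct[of k s h]
    card_mono[OF finite_verts, of "fst ` set h"] distinct_card[of "map fst h"]
  by (simp add: dom_map_of_conv_image_fst)

section \<open>Sufficient and necessary conditions for a win of Ann\<close>

lemma ann_winning_strategyI:
  assumes select: "\<And>h. play G k s h \<Longrightarrow> dom (map_of h) \<noteq> verts G \<Longrightarrow>
    s h \<in> verts G - dom (map_of h)"
    and safe: "\<And>h. play G k s h \<Longrightarrow> \<not> ben_wins G k (map_of h)"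
  shows "ann_winning_strategy G k s"
  unfolding ann_winning_strategy_def
proof (intro allI impI, elim conjE)
  fix h assume h: "play G k s h" and max: "\<nexists>r. play G k s (r # h)"
  have dom: "dom (map_of h) = verts G"
  proof (rule ccontr)
    assume "dom (map_of h) \<noteq> verts G"
    with select h have s: "s h \<in> verts G - dom (map_of h)" by blast
    \<comment> \<open>As Ben has not won, the selected vertex still has a legal colour, so the play
      has a further round, against its maximality.\<close>
    with safe[OF h] obtain a where "a \<in> legal_colors G k (map_of h) (s h)"
      unfolding ben_wins_def legal_colors_def by blast
    with play.round[OF h safe[OF h] s] max show False by blast
  qed
  have "map_of h u \<noteq> map_of h v" if "u \<rightarrow> v" for u v
  proof -
    have "u \<in> dom (map_of h)" using that adj_in_verts dom by blast
    then show ?thesis using play_proper[OF h that] by fastforce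
  qed
  then show "proper_coloring G k (map_of h)"
    using dom play_ran[OF h] unfolding proper_coloring_def by blast
qed

text \<open>Plays have bounded length, so a longest one exists and cannot be continued; its final
  position is the colouring. Thus a strategy is never winning vacuously.\<close>

lemma winning_imp_proper_coloring:
  assumes "ann_winning_strategy G k s"
  shows "\<exists>c. proper_coloring G k c"
proof -
  have "\<forall>h. play G k s h \<longrightarrow> length h < Suc (card (verts G))"
    using play_length le_imp_less_Suc by blast
  then obtain h where h: "play G k s h"
    and longest: "\<And>h'. play G k s h' \<Longrightarrow> length h' \<le> length h"
    using ex_has_greatest_nat[of "play G k s" "[]" length] play.start[of G k s] by blast
  have "\<nexists>r. play G k s (r # h)" using longest by fastforce
  with h show ?thesis using assms unfolding ann_winning_strategy_def by blast
qed

text \<open>When no position is lost for Ann, the order of selection is irrelevant and she may pick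
  any uncoloured vertex.\<close>

lemma winning_if_always_safe:
  assumes "\<And>c. dom c \<subseteq> verts G \<Longrightarrow> \<not> ben_wins G k c"
  shows "\<exists>s. ann_winning_strategy G k s"
proof
  show "ann_winning_strategy G k (\<lambda>h. SOME v. v \<in> verts G - dom (map_of h))"
  proof (rule ann_winning_strategyI)
    fix h assume "play G k (\<lambda>h. SOME v. v \<in> verts G - dom (map_of h)) h"
      and "dom (map_of h) \<noteq> verts G"
    then have "\<exists>v. v \<in> verts G - dom (map_of h)" using play_dom by blast
    then show "(SOME v. v \<in> verts G - dom (map_of h)) \<in> verts G - dom (map_of h)"
      by (rule someI_ex)
  qed (use assms play_dom in blast)
qed

text \<open>While some vertex is uncoloured, there are fewer coloured vertices than colours, so its
  neighbours cannot show all of them. This guarantees that the \<open>LEAST\<close> defining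
  \<open>\<chi>\<^sub>i\<close> is attained.\<close>

lemma winning_card_verts: "\<exists>s. ann_winning_strategy G (card (verts G)) s"
proof (rule winning_if_always_safe)
  fix c :: "'a \<rightharpoonup> nat" assume c: "dom c \<subseteq> verts G"
  show "\<not> ben_wins G (card (verts G)) c"
  proof
    assume "ben_wins G (card (verts G)) c"
    then obtain v where v: "v \<in> verts G - dom c" and "{1..card (verts G)} \<subseteq> ran c"
      unfolding ben_wins_def ran_def by blast
    then have "{1..card (verts G)} \<subseteq> (\<lambda>x. the (c x)) ` dom c"
      by (fastforce simp: ran_def dom_def image_iff)
    moreover have fin: "finite (dom c)" using c by (rule finite_subset) simp
    ultimately have "card (verts G) \<le> card (dom c)"
      using surj_card_le[of "dom c" "{1..card (verts G)}"] by simp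
    moreover have "card (dom c) < card (verts G)"
      using v c by (intro psubset_card_mono) auto
    ultimately show False by simp
  qed
qed

lemma winning_edgeless:
  assumes "arcs_ends G = {}"
  shows "\<exists>s. ann_winning_strategy G 1 s"
  using assms by (intro winning_if_always_safe) (auto simp: ben_wins_def)

section \<open>The forcing strategy on bipartite graphs\<close>

lemma winning_bipartite:
  assumes "proper_coloring G 2 g"
  shows "\<exists>s. ann_winning_strategy G 2 s"
proof -
  define adj where "adj c = {v \<in> verts G - dom c. \<exists>w \<in> dom c. v \<rightarrow> w}" for c :: "'a \<rightharpoonup> nat"
  define s where "s h = (SOME v. v \<in> (if adj (map_of h) \<noteq> {} then adj (map_of h)
    else verts G - dom (map_of h)))" for h :: "('a \<times> nat) list"
  have select: "s h \<in> (if adj (map_of h) \<noteq> {} then adj (map_of h) else verts G - dom (map_of h))"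
    if "verts G - dom (map_of h) \<noteq> {}" for h
    unfolding s_def by (rule someI_ex) (use that in auto)
  \<comment> \<open>The invariant asks for some extension, not for one fixed in advance:
    \<open>f\<close> may have to be replaced when Ann starts a new component.\<close>
  have extends: "\<exists>f. proper_coloring G 2 f \<and> map_of h \<subseteq>\<^sub>m f" if "play G 2 s h" for h
    using that
  proof (induction rule: play.induct)
    case start
    then show ?case using assms by auto
  next
    case (round h a)
    let ?c = "map_of h"
    obtain f where f: "proper_coloring G 2 f" and le: "?c \<subseteq>\<^sub>m f" using round.IH by blast
    have f_range: "f v \<in> {Some 1, Some 2}" if v: "v \<in> verts G" for v
    proof -
      obtain b where "f v = Some b" "b \<in> {1..2}" using proper_coloring_value[OF f v] .
      then show ?thesis by (auto simp: numeral_2_eq_2 le_Suc_eq)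
    qed
    have a: "a \<in> {1, 2}" "\<And>w. s h \<rightarrow> w \<Longrightarrow> ?c w \<noteq> Some a"
      using round.hyps(4) by (auto simp: legal_colors_def)
    have s: "s h \<in> verts G" "s h \<notin> dom ?c" using round.hyps(3) by auto
    show ?case
    proof (cases "f (s h) = Some a")
      case True
      then have "map_of ((s h, a) # h) \<subseteq>\<^sub>m f" using le by (auto simp: map_le_def)
      then show ?thesis using f by blast
    next
      case False
      \<comment> \<open>If \<open>s h\<close> had a coloured neighbour \<open>w\<close>, then
        \<open>a\<close> and the colour of \<open>s h\<close> under \<open>f\<close> would both
        differ from the colour of \<open>w\<close>; with only two colours they would
        coincide.\<close>
      have "adj ?c = {}"
      proof (rule ccontr)
        assume "adj ?c \<noteq> {}"
        then have "s h \<in> adj ?c" using select[of h] s by auto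
        then obtain w where w: "w \<in> dom ?c" "s h \<rightarrow> w" by (auto simp: adj_def)
        then have "f w = ?c w" using le by (auto simp: map_le_def)
        moreover have "f (s h) \<noteq> f w" using f w(2) by (auto simp: proper_coloring_def)
        moreover have "f w \<in> {Some 1, Some 2}" using f_range adj_in_verts(2)[OF w(2)] by blast
        ultimately show False
          using a(1) a(2)[OF w(2)] False f_range[OF s(1)] by auto
      qed
      \<comment> \<open>No edge joins a coloured to an uncoloured vertex, so changing
        \<open>f\<close> outside the domain of \<open>?c\<close> creates no conflict across the
        boundary.\<close>
      then have closed: "v \<in> dom ?c \<longleftrightarrow> w \<in> dom ?c" if "v \<rightarrow> w" for v w
        using that dominates_sym[OF that] adj_in_verts[OF that] by (auto simp: adj_def)
      \<comment> \<open>Sending \<open>b\<close> to \<open>3 - b\<close> swaps the colours 1 and 2,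
        which keeps the uncoloured part proper and turns the colour of \<open>s h\<close> into
        \<open>a\<close>.\<close>
      define f' where "f' v = (if v \<in> dom ?c then f v else map_option (\<lambda>b. 3 - b) (f v))" for v
      have "proper_coloring G 2 f'"
        unfolding proper_coloring_def
      proof (intro conjI allI impI)
        show "dom f' = verts G" using f by (auto simp: f'_def proper_coloring_def dom_def split: if_splits)
        have "f' v \<in> {Some 1, Some 2}" if "v \<in> verts G" for v
          using f_range[OF that] by (auto simp: f'_def)
        moreover have "v \<in> verts G" if "f' v = Some b" for v b
          using \<open>dom f' = verts G\<close> that by blast
        ultimately show "ran f' \<subseteq> {1..2}" by (fastforce simp: ran_def)
        show "f' v \<noteq> f' w" if "v \<rightarrow> w" for v w
        proof -
          have "f v \<noteq> f w" using f that by (auto simp: proper_coloring_def)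
          then show ?thesis
            using closed[OF that] f_range[OF adj_in_verts(1)[OF that]]
              f_range[OF adj_in_verts(2)[OF that]] by (auto simp: f'_def)
        qed
      qed
      moreover have "f' (s h) = Some a"
        using s False a(1) f_range[OF s(1)] by (auto simp: f'_def)
      then have "map_of ((s h, a) # h) \<subseteq>\<^sub>m f'" using le s(2) by (auto simp: map_le_def f'_def)
      ultimately show ?thesis by blast
    qed
  qed
  have "ann_winning_strategy G 2 s"
  proof (rule ann_winning_strategyI)
    fix h assume h: "play G 2 s h"
    show "s h \<in> verts G - dom (map_of h)" if "dom (map_of h) \<noteq> verts G"
    proof -
      have "verts G - dom (map_of h) \<noteq> {}" using play_dom[OF h] that by blast
      from select[OF this] show ?thesis by (auto simp: adj_def split: if_splits)
    qed
    obtain f where f: "proper_coloring G 2 f" and le: "map_of h \<subseteq>\<^sub>m f" using extends[OF h] by blast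
    show "\<not> ben_wins G 2 (map_of h)"
    proof
      assume "ben_wins G 2 (map_of h)"
      then obtain v where v: "v \<in> verts G"
        and all: "\<forall>a \<in> {1..2}. \<exists>w. v \<rightarrow> w \<and> map_of h w = Some a"
        unfolding ben_wins_def by blast
      \<comment> \<open>The colour of \<open>v\<close> under \<open>f\<close> occurs on no neighbour
        under \<open>f\<close>, hence on none in the partial colouring, so \<open>v\<close> is not
        blocked.\<close>
      obtain a where a: "f v = Some a" "a \<in> {1..2}" using proper_coloring_value[OF f v] .
      with all obtain w where w: "v \<rightarrow> w" "map_of h w = Some a" by blast
      have "f w = Some a" using w(2) le by (metis domI map_le_def)
      moreover have "f v \<noteq> f w" using f w(1) unfolding proper_coloring_def by blast
      ultimately show False using a(1) by simp
    qed
  qed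
  then show ?thesis by blast
qed

section \<open>Indicated chromatic number two\<close>

lemma indicated_chromatic_number_winning:
  "\<exists>s. ann_winning_strategy G (\<chi>\<^sub>i G) s"
  unfolding indicated_chromatic_number_def by (rule LeastI_ex) (use winning_card_verts in blast)

lemma indicated_chromatic_number_le:
  "ann_winning_strategy G k s \<Longrightarrow> \<chi>\<^sub>i G \<le> k"
  unfolding indicated_chromatic_number_def by (rule Least_le) blast

lemma proper_coloring_edge_two_le:
  assumes c: "proper_coloring G k c" and uv: "u \<rightarrow> v"
  shows "2 \<le> k"
proof -
  obtain a where "c u = Some a" "a \<in> {1..k}"
    using proper_coloring_value[OF c adj_in_verts(1)[OF uv]] .
  moreover obtain b where "c v = Some b" "b \<in> {1..k}"
    using proper_coloring_value[OF c adj_in_verts(2)[OF uv]] .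
  moreover have "c u \<noteq> c v" using c uv unfolding proper_coloring_def by blast
  ultimately show ?thesis by auto
qed

text \<open>Without edges one colour suffices for Ann, while an edge forces two colours in any
  proper colouring and hence in any win. The game disappears from the right-hand side, which is easy
  to check after deleting a vertex.\<close>

lemma indicated_chromatic_number_eq_2_iff:
  "\<chi>\<^sub>i G = 2 \<longleftrightarrow> arcs_ends G \<noteq> {} \<and> (\<exists>c. proper_coloring G 2 c)"
proof
  assume eq: "\<chi>\<^sub>i G = 2"
  have "arcs_ends G \<noteq> {}"
  proof
    assume "arcs_ends G = {}"
    then have "\<chi>\<^sub>i G \<le> 1" using winning_edgeless indicated_chromatic_number_le by blast
    with eq show False by simp
  qed
  moreover have "\<exists>c. proper_coloring G 2 c"
    using indicated_chromatic_number_winning eq winning_imp_proper_coloring by metis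
  ultimately show "arcs_ends G \<noteq> {} \<and> (\<exists>c. proper_coloring G 2 c)" ..
next
  assume *: "arcs_ends G \<noteq> {} \<and> (\<exists>c. proper_coloring G 2 c)"
  then have "\<chi>\<^sub>i G \<le> 2" using winning_bipartite indicated_chromatic_number_le by blast
  moreover obtain u v where "u \<rightarrow> v" using * by auto
  then have "2 \<le> \<chi>\<^sub>i G"
    using indicated_chromatic_number_winning winning_imp_proper_coloring
      proper_coloring_edge_two_le by blast
  ultimately show "\<chi>\<^sub>i G = 2" by simp
qed

section \<open>Deletion of a vertex\<close>

lemma arcs_ends_del_vert: "arcs_ends (del_vert x) = {(u, v) \<in> arcs_ends G. u \<noteq> x \<and> v \<noteq> x}"
  by (auto simp: arcs_ends_conv del_vert_simps)

text \<open>Makes the characterisation of \<open>\<chi>\<^sub>i\<close> being 2 available for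
  vertex-deleted graphs.\<close>

lemma graph_del_vert: "graph (del_vert x)"
proof -
  interpret D: digraph "del_vert x"
    by standard (auto simp: del_vert_simps ends_del_vert dest: no_loops intro: no_multi_arcs)
  show ?thesis
  proof (rule D.graphI)
    show "symmetric (del_vert x)"
      using dominates_sym unfolding symmetric_def by (auto simp: arcs_ends_del_vert intro: symI)
  qed
qed

lemma proper_coloring_del_vert:
  assumes c: "proper_coloring G k c"
  shows "proper_coloring (del_vert x) k (c |` (verts G - {x}))"
  unfolding proper_coloring_def
proof (intro conjI allI impI)
  show "dom (c |` (verts G - {x})) = verts (del_vert x)"
    using c by (simp add: proper_coloring_def verts_del_vert) blast
  show "ran (c |` (verts G - {x})) \<subseteq> {1..k}"
    using c by (auto simp: proper_coloring_def ran_def restrict_map_def)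
  show "(c |` (verts G - {x})) u \<noteq> (c |` (verts G - {x})) v" if "u \<rightarrow>\<^bsub>del_vert x\<^esub> v" for u v
    using c that adj_in_verts[of u v] by (auto simp: proper_coloring_def arcs_ends_del_vert)
qed

end

theorem proposition12:
  fixes G :: "('a, 'b) pre_digraph"
  assumes "graph G"
  shows "game_vertex_critical 2 G \<longleftrightarrow> K\<^bsub>2\<^esub> G"
proof -
  interpret graph G by fact
  show ?thesis
  proof
    assume crit: "game_vertex_critical 2 G"
    then have "\<chi>\<^sub>i G = 2" by (simp add: game_vertex_critical_def)
    then obtain c u v where c: "proper_coloring G 2 c" and uv: "u \<rightarrow>\<^bsub>G\<^esub> v"
      unfolding indicated_chromatic_number_eq_2_iff by auto
    have verts: "verts G = {u, v}"
    proof (rule ccontr)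
      assume "verts G \<noteq> {u, v}"
      then obtain x where x: "x \<in> verts G" "x \<noteq> u" "x \<noteq> v" using adj_in_verts[OF uv] by blast
      interpret D: graph "del_vert x" by (rule graph_del_vert)
      \<comment> \<open>The edge between \<open>u\<close> and \<open>v\<close> avoids
        \<open>x\<close> and survives, and the 2-colouring restricts, so deleting \<open>x\<close>
        contradicts criticality.\<close>
      have "\<chi>\<^sub>i (del_vert x) = 2"
        unfolding D.indicated_chromatic_number_eq_2_iff
        using proper_coloring_del_vert[OF c] x uv by (auto simp: arcs_ends_del_vert)
      then show False using crit x(1) unfolding game_vertex_critical_def by metis
    qed
    have "u \<noteq> v" using uv adj_not_same by blast
    moreover have "arcs_ends G = {(a, b). (a, b) \<in> verts G \<times> verts G \<and> a \<noteq> b}"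
      using uv dominates_sym[OF uv] adj_not_same adj_in_verts unfolding verts by blast
    ultimately show "K\<^bsub>2\<^esub> G" using verts assms by (simp add: complete_digraph_def)
  next
    assume K: "K\<^bsub>2\<^esub> G"
    then have "card (verts G) = 2" by (simp add: complete_digraph_def)
    then obtain u v where verts: "verts G = {u, v}" and "u \<noteq> v" by (auto simp: card_2_iff)
    then have ends: "arcs_ends G = {(u, v), (v, u)}" using K by (auto simp: complete_digraph_def)
    have "proper_coloring G 2 [u \<mapsto> 1, v \<mapsto> 2]"
      using \<open>u \<noteq> v\<close> verts ends by (auto simp: proper_coloring_def ran_def)
    then have chi: "\<chi>\<^sub>i G = 2" using ends indicated_chromatic_number_eq_2_iff by blast
    moreover have "\<chi>\<^sub>i (del_vert x) \<noteq> 2" if "x \<in> verts G" for x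
    proof -
      interpret D: graph "del_vert x" by (rule graph_del_vert)
      \<comment> \<open>Each vertex is an end of the only edge, so nothing survives the deletion of
        \<open>x\<close>.\<close>
      have "arcs_ends (del_vert x) = {}"
        using that verts ends by (auto simp: arcs_ends_del_vert)
      then show ?thesis unfolding D.indicated_chromatic_number_eq_2_iff by blast
    qed
    ultimately show "game_vertex_critical 2 G" by (simp add: game_vertex_critical_def)
  qed
qed

end
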